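(* Let $n\ge1$ and let $\{J,\mathcal E\}$ be the complex product structure on $\mathfrak{sl}(2n+1,\mathbb R)$ described in the context, with associated connection $\nabla^{\mathrm{CP}}$. Let $x,y\in\mathfrak{sl}(2n+1,\mathbb R)$ be given by $$x=\begin{bmatrix}A&C&w_1\\ B&D&w_2\\ v_1^t&v_2^t&-\operatorname{tr}(A+D)\end{bmatrix},\qquad y=\begin{bmatrix}E&G&z_1\\ F&H&z_2\\ y_1^t&y_2^t&-\operatorname{tr}(E+H)\end{bmatrix},$$ with $n\times n$ blocks $A,B,C,D,E,F,G,H$ and $v_i,w_i,y_i,z_i\in\mathbb R^n$, and let $x_\pm=\pi_\pm x$, $y_\pm=\pi_\pm y$. Then (i) $\nabla^{\mathrm{CP}}_{x_+}y_+=\begin{bmatrix}AE&0&0\\ BE+w_2y_1^t&0&Az_2+Ew_2+\operatorname{tr}(A)z_2\\ v_1^tE-\operatorname{tr}(A)y_1^t&0&-\operatorname{tr}(AE)\end{bmatrix}$; (ii) $\nabla^{\mathrm{CP}}_{x_-}y_+=\begin{bmatrix}CF+w_1y_1^t&0&0\\ DF&0&Dz_2-Fw_1+\operatorname{tr}(D)z_2\\ v_2^tF-\operatorname{tr}(D)y_1^t&0&-\operatorname{tr}(CF+w_1y_1^t)\end{bmatrix}$. The values of $\nabla^{\mathrm{CP}}_{x_+}y_-$ and $\nabla^{\mathrm{CP}}_{x_-}y_-$ are determined by these expressions and $\nabla^{\mathrm{CP}}J=0$.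
   Context: Elements of $\mathfrak{sl}(2n+1,\mathbb R)$ are written in blocks of sizes $n,n,1$. Define $$J\begin{bmatrix}A&C&w_1\\ B&D&w_2\\ v_1^t&v_2^t&-\operatorname{tr}(A+D)\end{bmatrix}=\begin{bmatrix}C&-A&w_2\\ D&-B&-w_1\\ v_2^t&-v_1^t&\operatorname{tr}(B-C)\end{bmatrix},\quad \mathcal E\begin{bmatrix}A&C&w_1\\ B&D&w_2\\ v_1^t&v_2^t&-\operatorname{tr}(A+D)\end{bmatrix}=\begin{bmatrix}A&-C&-w_1\\ B&-D&w_2\\ v_1^t&-v_2^t&\operatorname{tr}(D-A)\end{bmatrix}.$$ ($\mathcal E$ denotes the product structure, to distinguish it from the block $E$ of $y$.) The $(\pm1)$-eigenspaces of $\mathcal E$ are the subalgebras $$\mathfrak s_+=\left\{\begin{bmatrix}A&0&0\\ B&0&w_2\\ v_1^t&0&-\operatorname{tr}A\end{bmatrix}\right\},\qquad \mathfrak s_-=\left\{\begin{bmatrix}0&C&w_1\\ 0&D&0\\ 0&v_2^t&-\operatorname{tr}D\end{bmatrix}\right\},$$ and $\pi_\pm:\mathfrak{sl}(2n+1,\mathbb R)=\mathfrak s_+\oplus\mathfrak s_-\to\mathfrak s_\pm$ are the projections. $J$ is integrable, $J\mathcal E=-\mathcal EJ$, so $\{J,\mathcal E\}$ is a complex product structure. $\nabla^{\mathrm{CP}}$ is the unique torsion-free connection on the Lie algebra, i.e. bilinear product with $\nabla_xy-\nabla_yx=[x,y]$, satisfying $\nabla_x J=J\nabla_x$ and $\nabla_x\mathcal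 E=\mathcal E\nabla_x$ for all $x$. *)

theory Defs
  imports "HOL-Analysis.Analysis"
begin

(* The index type has 2n+1 elements, where n = CARD('n); its summands are the index
   ranges of the blocks of sizes n, n and 1. *)
type_synonym 'n mat = "real ^ 'n ^ 'n"
type_synonym 'n idx = "'n + 'n + unit"
type_synonym 'n bmat = "real ^ ('n + 'n + unit) ^ ('n + 'n + unit)"

(* The arguments of block are the blocks in reading order:
     [ A   C   w1 ]
     [ B   D   w2 ]
     [ v1  v2  s  ]   (v1 and v2 as rows). *)
definition block ::
  "'n::finite mat \<Rightarrow> 'n mat \<Rightarrow> real^'n \<Rightarrow>
   'n mat \<Rightarrow> 'n mat \<Rightarrow> real^'n \<Rightarrow>
   real^'n \<Rightarrow> real^'n \<Rightarrow> real \<Rightarrow> 'n bmat" where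
  "block A C w1 B D w2 v1 v2 s = (\<chi> i j.
     (case i of
        Inl a \<Rightarrow> (case j of Inl b \<Rightarrow> A $ a $ b | Inr (Inl b) \<Rightarrow> C $ a $ b | Inr (Inr _) \<Rightarrow> w1 $ a)
      | Inr (Inl a) \<Rightarrow> (case j of Inl b \<Rightarrow> B $ a $ b | Inr (Inl b) \<Rightarrow> D $ a $ b | Inr (Inr _) \<Rightarrow> w2 $ a)
      | Inr (Inr _) \<Rightarrow> (case j of Inl b \<Rightarrow> v1 $ b | Inr (Inl b) \<Rightarrow> v2 $ b | Inr (Inr _) \<Rightarrow> s)))"

abbreviation (input) idx1 :: "'n \<Rightarrow> 'n idx" where "idx1 a \<equiv> Inl a"
abbreviation (input) idx2 :: "'n \<Rightarrow> 'n idx" where "idx2 a \<equiv> Inr (Inl a)"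
abbreviation (input) idx3 :: "'n idx" where "idx3 \<equiv> Inr (Inr ())"

definition blkA :: "'n::finite bmat \<Rightarrow> 'n mat" where "blkA M = (\<chi> a b. M $ idx1 a $ idx1 b)"
definition blkC :: "'n::finite bmat \<Rightarrow> 'n mat" where "blkC M = (\<chi> a b. M $ idx1 a $ idx2 b)"
definition blkB :: "'n::finite bmat \<Rightarrow> 'n mat" where "blkB M = (\<chi> a b. M $ idx2 a $ idx1 b)"
definition blkD :: "'n::finite bmat \<Rightarrow> 'n mat" where "blkD M = (\<chi> a b. M $ idx2 a $ idx2 b)"
definition blkw1 :: "'n::finite bmat \<Rightarrow> real^'n" where "blkw1 M = (\<chi> a. M $ idx1 a $ idx3)"
definition blkw2 :: "'n::finite bmat \<Rightarrow> real^'n" where "blkw2 M = (\<chi> a. M $ idx2 a $ idx3)"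
definition blkv1 :: "'n::finite bmat \<Rightarrow> real^'n" where "blkv1 M = (\<chi> b. M $ idx3 $ idx1 b)"
definition blkv2 :: "'n::finite bmat \<Rightarrow> real^'n" where "blkv2 M = (\<chi> b. M $ idx3 $ idx2 b)"

lemma blk_block [simp]:
  "blkA (block A C w1 B D w2 v1 v2 s) = A" "blkC (block A C w1 B D w2 v1 v2 s) = C"
  "blkB (block A C w1 B D w2 v1 v2 s) = B" "blkD (block A C w1 B D w2 v1 v2 s) = D"
  "blkw1 (block A C w1 B D w2 v1 v2 s) = w1" "blkw2 (block A C w1 B D w2 v1 v2 s) = w2"
  "blkv1 (block A C w1 B D w2 v1 v2 s) = v1" "blkv2 (block A C w1 B D w2 v1 v2 s) = v2"
  by (simp_all add: block_def blkA_def blkB_def blkC_def blkD_def blkw1_def blkw2_def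
      blkv1_def blkv2_def vec_eq_iff)

lemma block_blk:
  "M = block (blkA M) (blkC M) (blkw1 M) (blkB M) (blkD M) (blkw2 M) (blkv1 M) (blkv2 M)
         (M $ idx3 $ idx3)"
  by (simp add: block_def blkA_def blkB_def blkC_def blkD_def blkw1_def blkw2_def
      blkv1_def blkv2_def vec_eq_iff split: sum.split)

lemma block_eq_iff:
  "block A C w1 B D w2 v1 v2 s = block A' C' w1' B' D' w2' v1' v2' s' \<longleftrightarrow>
     A = A' \<and> C = C' \<and> w1 = w1' \<and> B = B' \<and> D = D' \<and> w2 = w2' \<and> v1 = v1' \<and> v2 = v2' \<and> s = s'"
  by (auto simp: block_def vec_eq_iff split: sum.splits)

lemma uminus_block:
  "- block A C w1 B D w2 v1 v2 s =
     block (- A) (- C) (- w1) (- B) (- D) (- w2) (- v1) (- v2) (- s)"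
  by (simp add: block_def vec_eq_iff split: sum.split)

lemma trace_block: "trace (block A C w1 B D w2 v1 v2 s) = trace A + trace D + s"
proof -
  have *: "sum f (UNIV :: ('a + 'b) set) = (\<Sum>a\<in>UNIV. f (Inl a)) + (\<Sum>b\<in>UNIV. f (Inr b))"
    for f :: "'a::finite + 'b::finite \<Rightarrow> real"
    by (simp only: UNIV_Plus_UNIV [symmetric] sum.Plus finite comp_def)
  show ?thesis
    by (simp add: trace_def block_def * UNIV_unit)
qed

definition sl :: "'n::finite bmat set" where
  "sl = {M. trace M = 0}"

definition lie_br :: "'n::finite bmat \<Rightarrow> 'n bmat \<Rightarrow> 'n bmat" where
  "lie_br x y = x ** y - y ** x"

(* The matrix u v^t. *)
definition outer :: "real^'n \<Rightarrow> real^'n \<Rightarrow> 'n::finite mat" where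
  "outer u v = (\<chi> i j. u $ i * v $ j)"

(* J_cp and E_cp are the operators J and E of the complex product structure. Only their
   restrictions to sl matter, where the last diagonal entry of the argument is determined
   by the other blocks. *)
definition J_cp :: "'n::finite bmat \<Rightarrow> 'n bmat" where
  "J_cp M = block (blkC M)  (- blkA M)  (blkw2 M)
                  (blkD M)  (- blkB M)  (- blkw1 M)
                  (blkv2 M) (- blkv1 M) (trace (blkB M - blkC M))"

definition E_cp :: "'n::finite bmat \<Rightarrow> 'n bmat" where
  "E_cp M = block (blkA M)  (- blkC M)  (- blkw1 M)
                  (blkB M)  (- blkD M)  (blkw2 M)
                  (blkv1 M) (- blkv2 M) (trace (blkD M - blkA M))"

definition s_plus :: "'n::finite bmat set" where
  "s_plus = {M \<in> sl. E_cp M = M}"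

definition s_minus :: "'n::finite bmat set" where
  "s_minus = {M \<in> sl. E_cp M = - M}"

lemma neg_eq_self_mat: "- X = X \<longleftrightarrow> X = 0" "X = - X \<longleftrightarrow> X = 0" for X :: "real^'m^'k"
  by (auto simp: vec_eq_iff)

lemma neg_eq_self_vec: "- u = u \<longleftrightarrow> u = 0" "u = - u \<longleftrightarrow> u = 0" for u :: "real^'m"
  by (auto simp: vec_eq_iff)

lemma s_plus_eq:
  "s_plus = {block A  0 0
                   B  0 w2
                   v1 0 (- trace A) | A B w2 v1. True}" (is "?L = ?R")
proof
  show "?R \<subseteq> ?L"
    by (auto simp: s_plus_def sl_def E_cp_def trace_block block_eq_iff trace_sub)
       (simp_all add: trace_def)
  show "?L \<subseteq> ?R"
  proof
    fix M :: "'a bmat" assume M: "M \<in> ?L"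
    obtain A C w1 B D w2 v1 v2 s where b: "M = block A C w1 B D w2 v1 v2 s"
      using block_blk by blast
    from M have "C = 0" "w1 = 0" "D = 0" "v2 = 0" "s = trace D - trace A"
      by (auto simp: s_plus_def E_cp_def block_eq_iff trace_sub b
          neg_eq_self_mat neg_eq_self_vec)
    then show "M \<in> ?R"
      by (auto simp: b trace_def)
  qed
qed

lemma s_minus_eq:
  "s_minus = {block 0 C  w1
                    0 D  0
                    0 v2 (- trace D) | C w1 D v2. True}" (is "?L = ?R")
proof
  show "?R \<subseteq> ?L"
    by (auto simp: s_minus_def sl_def E_cp_def trace_block uminus_block block_eq_iff trace_sub)
       (simp_all add: trace_def)
  show "?L \<subseteq> ?R"
  proof
    fix M :: "'a bmat" assume M: "M \<in> ?L"
    obtain A C w1 B D w2 v1 v2 s where b: "M = block A C w1 B D w2 v1 v2 s"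
      using block_blk by blast
    from M have "A = 0" "B = 0" "w2 = 0" "v1 = 0" "trace A + trace D + s = 0"
      by (auto simp: s_minus_def sl_def E_cp_def trace_block uminus_block block_eq_iff b
          neg_eq_self_mat neg_eq_self_vec)
    then show "M \<in> ?R"
      by (auto simp: b trace_def block_eq_iff)
  qed
qed

definition pi_plus :: "'n::finite bmat \<Rightarrow> 'n bmat" where
  "pi_plus x = (THE p. p \<in> s_plus \<and> x - p \<in> s_minus)"

definition pi_minus :: "'n::finite bmat \<Rightarrow> 'n bmat" where
  "pi_minus x = (THE q. q \<in> s_minus \<and> x - q \<in> s_plus)"

(* Bilinear products on sl, encoded as functions that are undefined outside sl, so that
   equality of functions is equality of products on sl. *)
definition bilinear_product :: "('n::finite bmat \<Rightarrow> 'n bmat \<Rightarrow> 'n bmat) \<Rightarrow> bool" where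
  "bilinear_product N \<longleftrightarrow>
     N \<in> sl \<rightarrow>\<^sub>E (sl \<rightarrow>\<^sub>E sl) \<and>
     (\<forall>x\<in>sl. \<forall>x'\<in>sl. \<forall>y\<in>sl. \<forall>a b.
        N (a *\<^sub>R x + b *\<^sub>R x') y = a *\<^sub>R N x y + b *\<^sub>R N x' y) \<and>
     (\<forall>x\<in>sl. \<forall>y\<in>sl. \<forall>y'\<in>sl. \<forall>a b.
        N x (a *\<^sub>R y + b *\<^sub>R y') = a *\<^sub>R N x y + b *\<^sub>R N x y')"

definition torsion_free :: "('n::finite bmat \<Rightarrow> 'n bmat \<Rightarrow> 'n bmat) \<Rightarrow> bool" where
  "torsion_free N \<longleftrightarrow> (\<forall>x\<in>sl. \<forall>y\<in>sl. N x y - N y x = lie_br x y)"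

(* The condition that N_x commutes with T for all x. *)
definition parallel ::
  "('n::finite bmat \<Rightarrow> 'n bmat \<Rightarrow> 'n bmat) \<Rightarrow> ('n bmat \<Rightarrow> 'n bmat) \<Rightarrow> bool" where
  "parallel N T \<longleftrightarrow> (\<forall>x\<in>sl. \<forall>y\<in>sl. N x (T y) = T (N x y))"

definition nabla_CP :: "'n::finite bmat \<Rightarrow> 'n bmat \<Rightarrow> 'n bmat" where
  "nabla_CP = (THE N. bilinear_product N \<and> torsion_free N \<and> parallel N J_cp \<and> parallel N E_cp)"

end

(* Uniqueness: the difference D of two such connections is symmetric by torsion-freeness, hence
   commutes with J and E in both arguments, so
   J E D(x,y) = D(Jx,Ey) = E J D(x,y) = - J E D(x,y), and D = 0.
   Existence: the product cp_product is the bilinear extension of (i) and (ii) with the values for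
   y in s_minus forced by J-linearity, nabla_x y = - J nabla_x (J y). Torsion-freeness is a
   comparison of blocks; the last diagonal entry is determined by the vanishing trace. *)
theory Submission
  imports Defs
begin

section \<open>Block calculus and reduction of equations in \<open>sl\<close> to blocks\<close>

lemma sum_UNIV_sum_type:
  fixes f :: "'a::finite + 'b::finite \<Rightarrow> real"
  shows "sum f UNIV = (\<Sum>a\<in>UNIV. f (Inl a)) + (\<Sum>b\<in>UNIV. f (Inr b))"
  by (simp only: UNIV_Plus_UNIV [symmetric] sum.Plus finite comp_def)

lemma blk_lin:
  "blkA (- x) = - blkA x" "blkB (- x) = - blkB x" "blkC (- x) = - blkC x" "blkD (- x) = - blkD x"
  "blkw1 (- x) = - blkw1 x" "blkw2 (- x) = - blkw2 x"
  "blkv1 (- x) = - blkv1 x" "blkv2 (- x) = - blkv2 x"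
  "blkA (x + y) = blkA x + blkA y" "blkA (x - y) = blkA x - blkA y" "blkA (c *\<^sub>R x) = c *\<^sub>R blkA x"
  "blkB (x + y) = blkB x + blkB y" "blkB (x - y) = blkB x - blkB y" "blkB (c *\<^sub>R x) = c *\<^sub>R blkB x"
  "blkC (x + y) = blkC x + blkC y" "blkC (x - y) = blkC x - blkC y" "blkC (c *\<^sub>R x) = c *\<^sub>R blkC x"
  "blkD (x + y) = blkD x + blkD y" "blkD (x - y) = blkD x - blkD y" "blkD (c *\<^sub>R x) = c *\<^sub>R blkD x"
  "blkw1 (x + y) = blkw1 x + blkw1 y" "blkw1 (x - y) = blkw1 x - blkw1 y"
  "blkw1 (c *\<^sub>R x) = c *\<^sub>R blkw1 x"
  "blkw2 (x + y) = blkw2 x + blkw2 y" "blkw2 (x - y) = blkw2 x - blkw2 y"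
  "blkw2 (c *\<^sub>R x) = c *\<^sub>R blkw2 x"
  "blkv1 (x + y) = blkv1 x + blkv1 y" "blkv1 (x - y) = blkv1 x - blkv1 y"
  "blkv1 (c *\<^sub>R x) = c *\<^sub>R blkv1 x"
  "blkv2 (x + y) = blkv2 x + blkv2 y" "blkv2 (x - y) = blkv2 x - blkv2 y"
  "blkv2 (c *\<^sub>R x) = c *\<^sub>R blkv2 x"
  by (simp_all add: vec_eq_iff blkA_def blkB_def blkC_def blkD_def
      blkw1_def blkw2_def blkv1_def blkv2_def)

lemma blk_mult:
  fixes x y :: "'n::finite bmat"
  shows
    "blkA (x ** y) = blkA x ** blkA y + blkC x ** blkB y + outer (blkw1 x) (blkv1 y)"
    "blkC (x ** y) = blkA x ** blkC y + blkC x ** blkD y + outer (blkw1 x) (blkv2 y)"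
    "blkB (x ** y) = blkB x ** blkA y + blkD x ** blkB y + outer (blkw2 x) (blkv1 y)"
    "blkD (x ** y) = blkB x ** blkC y + blkD x ** blkD y + outer (blkw2 x) (blkv2 y)"
    "blkw1 (x ** y) = blkA x *v blkw1 y + blkC x *v blkw2 y + y $ idx3 $ idx3 *\<^sub>R blkw1 x"
    "blkw2 (x ** y) = blkB x *v blkw1 y + blkD x *v blkw2 y + y $ idx3 $ idx3 *\<^sub>R blkw2 x"
    "blkv1 (x ** y) = blkv1 x v* blkA y + blkv2 x v* blkB y + x $ idx3 $ idx3 *\<^sub>R blkv1 y"
    "blkv2 (x ** y) = blkv1 x v* blkC y + blkv2 x v* blkD y + x $ idx3 $ idx3 *\<^sub>R blkv2 y"
  by (simp_all add: vec_eq_iff blkA_def blkB_def blkC_def blkD_def blkw1_def blkw2_def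
      blkv1_def blkv2_def matrix_matrix_mult_def matrix_vector_mult_def vector_matrix_mult_def
      outer_def sum_UNIV_sum_type UNIV_unit algebra_simps)

lemma mult_lin:
  fixes A B M :: "real^'n::finite^'n" and u v w :: "real^'n"
  shows "(A + B) ** M = A ** M + B ** M" "M ** (A + B) = M ** A + M ** B"
    "(c *\<^sub>R A) ** M = c *\<^sub>R (A ** M)" "M ** (c *\<^sub>R A) = c *\<^sub>R (M ** A)"
    "(- A) ** M = - (A ** M)" "M ** (- A) = - (M ** A)"
    "(A + B) *v u = A *v u + B *v u" "M *v (u + v) = M *v u + M *v v"
    "(c *\<^sub>R A) *v u = c *\<^sub>R (A *v u)" "M *v (c *\<^sub>R u) = c *\<^sub>R (M *v u)"
    "(- A) *v u = - (A *v u)" "M *v (- u) = - (M *v u)"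
    "u v* (A + B) = u v* A + u v* B" "(u + v) v* M = u v* M + v v* M"
    "u v* (c *\<^sub>R A) = c *\<^sub>R (u v* A)" "(c *\<^sub>R u) v* M = c *\<^sub>R (u v* M)"
    "u v* (- A) = - (u v* A)" "(- u) v* M = - (u v* M)"
    "outer (u + v) w = outer u w + outer v w" "outer w (u + v) = outer w u + outer w v"
    "outer (c *\<^sub>R u) w = c *\<^sub>R outer u w" "outer w (c *\<^sub>R u) = c *\<^sub>R outer w u"
    "outer (- u) w = - outer u w" "outer w (- u) = - outer w u"
  by (simp_all add: vec_eq_iff matrix_matrix_mult_def matrix_vector_mult_def
      vector_matrix_mult_def outer_def sum.distrib sum_negf sum_distrib_left algebra_simps)

lemma trace_lin:
  "trace (x - y) = trace x - trace y" "trace (x + y) = trace x + trace y"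
  "trace (- x) = - trace x" "trace (c *\<^sub>R x) = c * trace x" "trace (0 :: real^'n^'n) = 0"
  for x y :: "real^'n^'n"
  by (simp_all add: trace_def sum_subtractf sum.distrib sum_negf sum_distrib_left)

lemma trace_blk: "trace x = trace (blkA x) + trace (blkD x) + x $ idx3 $ idx3"
  by (subst block_blk [of x]) (simp only: trace_block)

lemma sl_last: "x \<in> sl \<Longrightarrow> x $ idx3 $ idx3 = - trace (blkA x) - trace (blkD x)"
  using trace_blk [of x] by (simp add: sl_def)

text \<open>The vanishing trace fixes the corner entry, so eight block identities suffice. The later
  identities of maps into \<open>sl\<close> are all proved this way, after membership of both sides
  in \<open>sl\<close>.\<close>

lemma bmat_eqI_sl:
  assumes "x \<in> sl" "y \<in> sl"
    and "blkA x = blkA y" "blkB x = blkB y" "blkC x = blkC y" "blkD x = blkD y"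
    and "blkw1 x = blkw1 y" "blkw2 x = blkw2 y" "blkv1 x = blkv1 y" "blkv2 x = blkv2 y"
  shows "x = y"
proof -
  have "x $ idx3 $ idx3 = y $ idx3 $ idx3"
    using assms by (simp add: sl_last)
  then show ?thesis
    by (subst block_blk [of x], subst block_blk [of y]) (simp only: assms(3-))
qed

lemma sl_lin:
  "x \<in> sl \<Longrightarrow> y \<in> sl \<Longrightarrow> x + y \<in> sl" "x \<in> sl \<Longrightarrow> y \<in> sl \<Longrightarrow> x - y \<in> sl"
  "x \<in> sl \<Longrightarrow> - x \<in> sl" "x \<in> sl \<Longrightarrow> c *\<^sub>R x \<in> sl" "0 \<in> sl"
  by (simp_all add: sl_def trace_lin)

section \<open>The operators J and E\<close>

lemma J_cp_sl [simp]: "J_cp x \<in> sl" and E_cp_sl [simp]: "E_cp x \<in> sl"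
  by (simp_all add: J_cp_def E_cp_def sl_def trace_block trace_lin)

lemma lie_br_sl: "lie_br x y \<in> sl"
  using trace_mul_sym [of x y] by (simp add: lie_br_def sl_def trace_lin)

text \<open>\<open>J_cp\<close> ignores the corner of its argument; only the trace condition lets a
  second application recover it.\<close>

lemma J_cp_J_cp: "x \<in> sl \<Longrightarrow> J_cp (J_cp x) = - x"
  by (rule bmat_eqI_sl) (simp_all add: sl_lin, simp_all add: J_cp_def blk_lin)

lemma E_cp_E_cp: "x \<in> sl \<Longrightarrow> E_cp (E_cp x) = x"
  by (rule bmat_eqI_sl) (simp_all, simp_all add: E_cp_def)

lemma J_cp_E_cp: "J_cp (E_cp x) = - E_cp (J_cp x)"
  by (simp add: J_cp_def E_cp_def uminus_block block_eq_iff trace_lin)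

lemma J_cp_diff: "J_cp (x - y) = J_cp x - J_cp y"
  by (rule bmat_eqI_sl) (simp_all add: sl_lin, simp_all add: blk_lin J_cp_def)

lemma E_cp_diff: "E_cp (x - y) = E_cp x - E_cp y"
  by (rule bmat_eqI_sl) (simp_all add: sl_lin, simp_all add: blk_lin E_cp_def)

lemma J_cp_0 [simp]: "J_cp 0 = 0" and E_cp_0 [simp]: "E_cp 0 = 0"
  using J_cp_diff [of 0 0] E_cp_diff [of 0 0] by simp_all

lemma J_cp_minus: "J_cp (- x) = - J_cp x"
  and E_cp_minus: "E_cp (- x) = - E_cp x"
  using J_cp_diff [of 0 x] E_cp_diff [of 0 x] by simp_all

section \<open>Uniqueness and existence of the connection\<close>

lemma complex_product_connection_unique:
  assumes N: "bilinear_product N" "torsion_free N" "parallel N J_cp" "parallel N E_cp"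
    and M: "bilinear_product M" "torsion_free M" "parallel M J_cp" "parallel M E_cp"
  shows "N = M"
proof -
  define D where "D x y = N x y - M x y" for x y
  have NE: "N \<in> sl \<rightarrow>\<^sub>E (sl \<rightarrow>\<^sub>E sl)" and ME: "M \<in> sl \<rightarrow>\<^sub>E (sl \<rightarrow>\<^sub>E sl)"
    using N M by (simp_all add: bilinear_product_def)
  have cl: "N x y \<in> sl" "M x y \<in> sl" "D x y \<in> sl" if "x \<in> sl" "y \<in> sl" for x y
    using NE ME that unfolding D_def by (auto intro!: sl_lin simp: PiE_iff)
  have sym: "D x y = D y x" if "x \<in> sl" "y \<in> sl" for x y
  proof -
    have "N x y - N y x = M x y - M y x"
      using N M that by (simp add: torsion_free_def)
    then show ?thesis by (simp add: D_def algebra_simps)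
  qed
  have J: "D x (J_cp y) = J_cp (D x y)" and E: "D x (E_cp y) = E_cp (D x y)"
    if "x \<in> sl" "y \<in> sl" for x y
    using N M that by (simp_all add: D_def parallel_def J_cp_diff E_cp_diff)
  have D0: "D x y = 0" if xy: "x \<in> sl" "y \<in> sl" for x y
  proof -
    \<comment> \<open>J and E can only be pulled out of the second argument; symmetry of
      \<open>D\<close> moves the first argument there. The order of extraction decides the order of
      the operators in the result.\<close>
    have "D (J_cp x) (E_cp y) = E_cp (J_cp (D x y))"
      using xy E [of "J_cp x" y] J [of y x] sym [of "J_cp x" y] sym [of x y] by simp
    moreover have "D (J_cp x) (E_cp y) = J_cp (E_cp (D x y))"
      using xy J [of "E_cp y" x] E [of x y] sym [of "J_cp x" "E_cp y"] sym [of x "E_cp y"] by simp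
    ultimately have "E_cp (J_cp (D x y)) = 0"
      by (simp add: J_cp_E_cp neg_eq_self_mat)
    \<comment> \<open>On \<open>sl\<close>, E is its own inverse and J is inverted by -J, so both
      can be cancelled.\<close>
    then have "J_cp (D x y) = 0"
      using E_cp_E_cp [of "J_cp (D x y)"] by simp
    then have "- D x y = 0"
      using J_cp_J_cp [of "D x y"] cl xy by simp
    then show ?thesis
      by (simp only: neg_equal_0_iff_equal)
  qed
  show ?thesis
  \<comment> \<open>Both products take the same default value outside \<open>sl\<close>, so
    agreement on \<open>sl\<close> in each argument gives equality of functions.\<close>
  proof (rule PiE_ext [OF NE ME])
    fix x :: "'a bmat" assume x: "x \<in> sl"
    show "N x = M x"
    proof (rule PiE_ext)
      show "N x \<in> sl \<rightarrow>\<^sub>E sl" "M x \<in> sl \<rightarrow>\<^sub>E sl"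
        using NE ME x by auto
      show "N x y = M x y" if "y \<in> sl" for y
        using D0 [OF x that] by (simp add: D_def)
    qed
  qed
qed

text \<open>The blocks in the positions of \<open>s_plus\<close> add (i) and (ii), the contributions
  of the two components of x. Those in the positions of \<open>s_minus\<close> arise by replacing E,
  F, z2, y1 with G, H, -z1, y2, that is y with Jy, and then applying -J. The corner makes the trace
  vanish.\<close>

definition cp_product :: "'n::finite bmat \<Rightarrow> 'n bmat \<Rightarrow> 'n bmat" where
  "cp_product x y =
     (let A = blkA x; C = blkC x; w1 = blkw1 x; B = blkB x; D = blkD x; w2 = blkw2 x;
          v1 = blkv1 x; v2 = blkv2 x;
          E = blkA y; G = blkC y; z1 = blkw1 y; F = blkB y; H = blkD y; z2 = blkw2 y;
          y1 = blkv1 y; y2 = blkv2 y;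
          P = A ** E + C ** F + outer w1 y1; Q = B ** G + D ** H + outer w2 y2;
          t = trace A + trace D
      in block
        P (A ** G + C ** H + outer w1 y2) (A *v z1 - G *v w2 + D *v z1 + H *v w1 + t *\<^sub>R z1)
        (B ** E + D ** F + outer w2 y1) Q (A *v z2 + E *v w2 + D *v z2 - F *v w1 + t *\<^sub>R z2)
        (v1 v* E + v2 v* F - t *\<^sub>R y1) (v1 v* G + v2 v* H - t *\<^sub>R y2) (- trace P - trace Q))"

lemma cp_product_sl [simp]: "cp_product x y \<in> sl"
  by (simp add: cp_product_def sl_def trace_block Let_def)

lemma cp_product_lin_left:
  "cp_product (a *\<^sub>R x + b *\<^sub>R x') y = a *\<^sub>R cp_product x y + b *\<^sub>R cp_product x' y"
  by (rule bmat_eqI_sl)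
     (simp_all add: sl_lin,
      simp_all add: cp_product_def Let_def blk_lin mult_lin trace_lin algebra_simps)

lemma cp_product_lin_right:
  "cp_product x (a *\<^sub>R y + b *\<^sub>R y') = a *\<^sub>R cp_product x y + b *\<^sub>R cp_product x y'"
  by (rule bmat_eqI_sl)
     (simp_all add: sl_lin,
      simp_all add: cp_product_def Let_def blk_lin mult_lin trace_lin algebra_simps)

text \<open>For x and y in \<open>sl\<close>, the first two block columns of
  \<open>cp_product x y\<close>, apart from the corner, are those of \<open>x ** y\<close>, since
  the corner of x is -t. The upper two blocks of the last column differ from those of
  \<open>x ** y\<close> by terms symmetric in x and y, which cancel on antisymmetrising.\<close>

lemma cp_product_torsion_free:
  "x \<in> sl \<Longrightarrow> y \<in> sl \<Longrightarrow> cp_product x y - cp_product y x = lie_br x y"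
  by (rule bmat_eqI_sl)
     (simp_all add: sl_lin lie_br_sl,
      simp_all add: lie_br_def cp_product_def Let_def blk_lin blk_mult sl_last algebra_simps)

text \<open>In the first two block columns x acts from the left while J permutes columns up to sign,
  so the two commute. In the last column, substituting the blocks of Jy turns the formula for
  \<open>w1\<close> into that for \<open>w2\<close>, and the one for \<open>w2\<close> into minus
  that for \<open>w1\<close>.\<close>

lemma cp_product_J_cp: "cp_product x (J_cp y) = J_cp (cp_product x y)"
  by (rule bmat_eqI_sl)
     (simp, simp, simp_all add: J_cp_def cp_product_def Let_def mult_lin trace_lin algebra_simps)

text \<open>The blocks in the positions of \<open>s_plus\<close> depend only on the same blocks of
  y, and likewise for \<open>s_minus\<close>; hence both eigenspaces are preserved.\<close>

lemma cp_product_E_cp: "cp_product x (E_cp y) = E_cp (cp_product x y)"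
  by (rule bmat_eqI_sl)
     (simp, simp, simp_all add: E_cp_def cp_product_def Let_def mult_lin trace_lin algebra_simps)

lemma cp_product_connection:
  defines "N \<equiv> restrict (\<lambda>x. restrict (cp_product x) sl) sl"
  shows "bilinear_product N" "torsion_free N" "parallel N J_cp" "parallel N E_cp"
  by (auto simp: N_def bilinear_product_def torsion_free_def parallel_def sl_lin
      cp_product_lin_left cp_product_lin_right cp_product_torsion_free cp_product_J_cp
      cp_product_E_cp)

lemma nabla_CP_eq: "nabla_CP = restrict (\<lambda>x. restrict (cp_product x) sl) sl"
  unfolding nabla_CP_def
  using cp_product_connection complex_product_connection_unique
  by (intro the_equality) blast+

lemma nabla_CP_apply: "x \<in> sl \<Longrightarrow> y \<in> sl \<Longrightarrow> nabla_CP x y = cp_product x y"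
  by (simp add: nabla_CP_eq)

section \<open>Eigenspaces and projections\<close>

lemma s_plus_inter_s_minus: "p \<in> s_plus \<Longrightarrow> p \<in> s_minus \<Longrightarrow> p = 0"
  by (auto simp: s_plus_def s_minus_def neg_eq_self_mat)

lemma s_plus_diff: "p \<in> s_plus \<Longrightarrow> q \<in> s_plus \<Longrightarrow> p - q \<in> s_plus"
  and s_minus_diff: "p \<in> s_minus \<Longrightarrow> q \<in> s_minus \<Longrightarrow> p - q \<in> s_minus"
  by (simp_all add: s_plus_def s_minus_def sl_lin E_cp_diff)

lemma pi_plus_eqI:
  assumes "p \<in> s_plus" "x - p \<in> s_minus"
  shows "pi_plus x = p"
  unfolding pi_plus_def
proof (rule the_equality)
  fix q assume "q \<in> s_plus \<and> x - q \<in> s_minus"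
  \<comment> \<open>The second difference is again q - p, which therefore lies in both
    eigenspaces.\<close>
  then have "q - p \<in> s_plus" "(x - p) - (x - q) \<in> s_minus"
    using assms s_plus_diff s_minus_diff by blast+
  then show "q = p"
    using s_plus_inter_s_minus [of "q - p"] by simp
qed (use assms in simp)

lemma pi_minus_eqI:
  assumes "p \<in> s_minus" "x - p \<in> s_plus"
  shows "pi_minus x = p"
  unfolding pi_minus_def
proof (rule the_equality)
  fix q assume "q \<in> s_minus \<and> x - q \<in> s_plus"
  then have "q - p \<in> s_minus" "(x - p) - (x - q) \<in> s_plus"
    using assms s_plus_diff s_minus_diff by blast+
  then show "q = p"
    using s_plus_inter_s_minus [of "q - p"] by simp
qed (use assms in simp)

lemma pi_plus_self: "p \<in> s_plus \<Longrightarrow> pi_plus p = p"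
  by (intro pi_plus_eqI) (simp_all add: s_minus_def sl_lin)

lemma pi_block:
  fixes A B C D :: "real^'n::finite^'n" and w1 w2 v1 v2 :: "real^'n"
  defines "x \<equiv> block A C w1 B D w2 v1 v2 (- trace (A + D))"
  shows pi_plus_block: "pi_plus x = block A 0 0 B 0 w2 v1 0 (- trace A)"
    and pi_minus_block: "pi_minus x = block 0 C w1 0 D 0 0 v2 (- trace D)"
proof -
  let ?p = "block A 0 0 B 0 w2 v1 0 (- trace A)" and ?q = "block 0 C w1 0 D 0 0 v2 (- trace D)"
  have pq: "x - ?p = ?q" "x - ?q = ?p"
    by (simp_all add: x_def block_def vec_eq_iff trace_lin split: sum.split)
  have "?p \<in> s_plus" "?q \<in> s_minus"
    unfolding s_plus_eq s_minus_eq by blast+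
  with pq show "pi_plus x = ?p" "pi_minus x = ?q"
    by (simp_all add: pi_plus_eqI pi_minus_eqI)
qed

text \<open>Anticommuting with E, J sends the eigenvalue -1 to +1.\<close>

lemma J_cp_s_minus: "q \<in> s_minus \<Longrightarrow> J_cp q \<in> s_plus"
  using J_cp_E_cp [of q] by (simp add: s_minus_def s_plus_def J_cp_minus)

text \<open>Apply -J to the parallelism of J and use that J squares to -1. As Jq lies in
  \<open>s_plus\<close>, this reduces values on \<open>s_minus\<close> to (i) and (ii).\<close>

lemma nabla_CP_s_minus:
  assumes "u \<in> sl" "q \<in> s_minus"
  shows "nabla_CP u q = - J_cp (nabla_CP u (J_cp q))"
proof -
  have "q \<in> sl"
    using assms by (simp add: s_minus_def)
  then show ?thesis
    using assms by (simp add: nabla_CP_apply cp_product_J_cp J_cp_J_cp)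
qed

theorem proposition5p1:
  fixes A B C D E F G H :: "real ^ 'n::finite ^ 'n"
    and v1 v2 w1 w2 y1 y2 z1 z2 :: "real ^ 'n"
    and x y :: "'n bmat"
  assumes x: "x = block A  C  w1
                        B  D  w2
                        v1 v2 (- trace (A + D))"
    and y: "y = block E  G  z1
                      F  H  z2
                      y1 y2 (- trace (E + H))"
  shows
    "nabla_CP (pi_plus x) (pi_plus y) =
       block (A ** E)                    0 0
             (B ** E + outer w2 y1)      0 (A *v z2 + E *v w2 + trace A *\<^sub>R z2)
             (v1 v* E - trace A *\<^sub>R y1)  0 (- trace (A ** E)) \<and>
     nabla_CP (pi_minus x) (pi_plus y) =
       block (C ** F + outer w1 y1)      0 0
             (D ** F)                    0 (D *v z2 - F *v w1 + trace D *\<^sub>R z2)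
             (v2 v* F - trace D *\<^sub>R y1)  0 (- trace (C ** F + outer w1 y1)) \<and>
     J_cp (pi_minus y) \<in> s_plus \<and>
     nabla_CP (pi_plus x) (pi_minus y) = - J_cp (nabla_CP (pi_plus x) (J_cp (pi_minus y))) \<and>
     nabla_CP (pi_minus x) (pi_minus y) = - J_cp (nabla_CP (pi_minus x) (J_cp (pi_minus y))) \<and>
     (\<forall>N. bilinear_product N \<and> parallel N J_cp \<and>
         (\<forall>u\<in>sl. \<forall>v\<in>sl. N (pi_plus u) (pi_plus v) = nabla_CP (pi_plus u) (pi_plus v) \<and>
                        N (pi_minus u) (pi_plus v) = nabla_CP (pi_minus u) (pi_plus v)) \<longrightarrow>
         N (pi_plus x) (pi_minus y) = nabla_CP (pi_plus x) (pi_minus y) \<and>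
         N (pi_minus x) (pi_minus y) = nabla_CP (pi_minus x) (pi_minus y))"
proof -
  have xsl: "x \<in> sl"
    by (simp add: x y sl_def trace_block trace_lin)
  have "pi_plus x \<in> s_plus" "pi_minus x \<in> s_minus"
    and "pi_plus y \<in> s_plus" and my: "pi_minus y \<in> s_minus"
    unfolding x y pi_plus_block pi_minus_block s_plus_eq s_minus_eq by blast+
  then have sl: "pi_plus x \<in> sl" "pi_minus x \<in> sl" "pi_plus y \<in> sl" "pi_minus y \<in> sl"
    by (simp_all add: s_plus_def s_minus_def)
  \<comment> \<open>The projections have zero blocks; passing to entries makes the terms containing
    them vanish.\<close>
  note zeros = matrix_matrix_mult_def matrix_vector_mult_def vector_matrix_mult_def outer_def
    vec_eq_iff trace_lin
  have pp: "nabla_CP (pi_plus x) (pi_plus y) =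
       block (A ** E)                    0 0
             (B ** E + outer w2 y1)      0 (A *v z2 + E *v w2 + trace A *\<^sub>R z2)
             (v1 v* E - trace A *\<^sub>R y1)  0 (- trace (A ** E))"
    unfolding nabla_CP_apply [OF sl(1) sl(3)]
    by (simp add: x y pi_plus_block cp_product_def block_eq_iff Let_def)
       (simp add: zeros trace_def)
  have mp: "nabla_CP (pi_minus x) (pi_plus y) =
       block (C ** F + outer w1 y1)      0 0
             (D ** F)                    0 (D *v z2 - F *v w1 + trace D *\<^sub>R z2)
             (v2 v* F - trace D *\<^sub>R y1)  0 (- trace (C ** F + outer w1 y1))"
    unfolding nabla_CP_apply [OF sl(2) sl(3)]
    by (simp add: x y pi_plus_block pi_minus_block cp_product_def block_eq_iff Let_def)
       (simp add: zeros trace_def)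
  have det: "N u (pi_minus y) = nabla_CP u (pi_minus y)"
    if N: "parallel N J_cp" and u: "u \<in> sl"
      and eq: "\<And>v. v \<in> sl \<Longrightarrow> N u (pi_plus v) = nabla_CP u (pi_plus v)" for N u
  proof -
    \<comment> \<open>Chosen so that J maps it to \<open>pi_minus y\<close>. It lies in
      \<open>s_plus\<close> and is thus fixed by \<open>pi_plus\<close>, so the agreement assumed
      for N applies to it and parallelism of J carries it over.\<close>
    let ?v = "J_cp (- pi_minus y)"
    have "- pi_minus y \<in> s_minus"
      using my by (simp add: s_minus_def E_cp_minus sl_lin)
    then have v: "?v \<in> s_plus"
      by (rule J_cp_s_minus)
    have "J_cp ?v = pi_minus y"
      using sl by (simp add: J_cp_J_cp sl_lin)
    moreover have "N u (J_cp ?v) = nabla_CP u (J_cp ?v)"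
      using N u eq [of ?v] v
      by (simp add: parallel_def pi_plus_self nabla_CP_apply cp_product_J_cp)
    ultimately show ?thesis by simp
  qed
  show ?thesis
    using pp mp J_cp_s_minus [OF my] nabla_CP_s_minus [OF sl(1) my] nabla_CP_s_minus [OF sl(2) my]
      xsl det sl by blast
qed

end
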